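(* Let $p$ be an odd prime and let $i\ge2$ be an integer. Then $2p^i$ and $p^i$ are consecutive with respect to the strict total ordering $\prec$ on the positive integers, and $2p^i\prec p^i$. (That is, $2p^i\prec p^i$ and there is no positive integer $n$ with $2p^i\prec n\prec p^i$.)
   Context: For a positive integer $n$, $\Phi_n$ denotes the $n$-th cyclotomic polynomial. The ordering $\prec$ on the positive integers is defined as follows: fix any real number $x>2$, and write $m\prec n$ if $\Phi_m(x)<\Phi_n(x)$. This is a strict total ordering that does not depend on the choice of $x>2$ (because $\Phi_m(x)\ne\Phi_n(x)$ for all real $x>2$ whenever $m\ne n$). *)

theory Defs
  imports
    Complex_Main
    "HOL-Computational_Algebra.Computational_Algebra"
begin

definition primitive_unity_roots :: "nat \<Rightarrow> complex set" where
  "primitive_unity_roots n = {z. z ^ n = 1 \<and> (\<forall>m. 0 < m \<and> m < n \<longrightarrow> z ^ m \<noteq> 1)}"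

definition complex_cyclotomic :: "nat \<Rightarrow> complex poly" where
  "complex_cyclotomic n = (\<Prod>z\<in>primitive_unity_roots n. [:- z, 1:])"

text \<open>
  The defining product has integer coefficients, so the polynomial is taken in \<open>\<int>[X]\<close>; the
  description is justified by \<open>of_int_poly_cyclotomic\<close> below.
\<close>
definition cyclotomic :: "nat \<Rightarrow> int poly" where
  "cyclotomic n = (THE p. map_poly of_int p = complex_cyclotomic n)"

text \<open>
  The ordering is the same for every real \<open>x > 2\<close>; the evaluation point is kept as a parameter, so that
  a statement for arbitrary \<open>x > 2\<close> does not rest on this independence.
\<close>
definition cyclotomic_less :: "real \<Rightarrow> nat \<Rightarrow> nat \<Rightarrow> bool" where
  "cyclotomic_less x m n \<longleftrightarrow> poly (map_poly of_int (cyclotomic m)) x < poly (map_poly of_int (cyclotomic n)) x"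

lemma of_int_poly_mult: "map_poly of_int (p * q) = (map_poly of_int p * map_poly of_int q :: complex poly)"
  by (rule poly_eqI) (simp add: coeff_map_poly coeff_mult)

lemma of_int_poly_add: "map_poly of_int (p + q) = (map_poly of_int p + map_poly of_int q :: complex poly)"
  by (rule poly_eqI) (simp add: coeff_map_poly)

lemma of_int_poly_inj: "map_poly of_int p = (map_poly of_int q :: complex poly) \<Longrightarrow> p = q"
  by (rule poly_eqI) (metis coeff_map_poly of_int_0 of_int_eq_iff)

lemma degree_of_int_poly: "degree (map_poly of_int p :: complex poly) = degree p"
  by (rule degree_map_poly) simp

lemma int_quotient:
  fixes f :: "complex poly"
  assumes q: "lead_coeff q = (1::int)" and eq: "map_poly of_int q * f = map_poly of_int g"
  shows "\<exists>s. map_poly of_int s = f"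
proof -
  obtain s r where sr: "pseudo_divmod g q = (s, r)" by fastforce
  have q0: "q \<noteq> 0" using q by auto
  have g: "g = q * s + r" and r: "r = 0 \<or> degree r < degree q"
    using pseudo_divmod[OF q0 sr] q by auto
  let ?h = "map_poly of_int :: int poly \<Rightarrow> complex poly"
  have q0': "?h q \<noteq> 0"
    using q0 of_int_poly_inj[of q 0] by auto
  have R: "?h q * (f - ?h s) = ?h r"
    using eq by (simp add: g of_int_poly_mult of_int_poly_add algebra_simps)
  have "f - ?h s = 0"
  proof (rule ccontr)
    assume n: "f - ?h s \<noteq> 0"
    then have "degree (?h r) = degree q + degree (f - ?h s)"
      using R q0' by (metis degree_mult_eq degree_of_int_poly)
    moreover have "r \<noteq> 0" using R n q0' by auto
    ultimately show False using r by (simp add: degree_of_int_poly)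
  qed
  then show ?thesis by auto
qed

lemma finite_primitive_unity_roots: "n > 0 \<Longrightarrow> finite (primitive_unity_roots n)"
  using finite_roots_unity[of n] by (auto simp: primitive_unity_roots_def intro: finite_subset)

lemma monic_complex_cyclotomic: "lead_coeff (complex_cyclotomic n) = 1"
  by (simp add: complex_cyclotomic_def lead_coeff_prod)

lemma unity_roots_decomp:
  assumes n: "n > 0"
  shows "{z::complex. z ^ n = 1} = (\<Union>d\<in>{d. d dvd n}. primitive_unity_roots d)"
proof (intro equalityI subsetI)
  fix z :: complex
  assume z: "z \<in> {z. z ^ n = 1}"
  define d where "d = (LEAST d. d > 0 \<and> z ^ d = 1)"
  have d: "d > 0 \<and> z ^ d = 1"
    unfolding d_def by (rule LeastI[of _ n]) (use n z in auto)
  have least: "z ^ m \<noteq> 1" if "0 < m" "m < d" for m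
    using not_less_Least that unfolding d_def by blast
  have "z ^ n = (z ^ d) ^ (n div d) * z ^ (n mod d)"
    by (simp flip: power_mult power_add)
  then have "z ^ (n mod d) = 1" using d z by simp
  then have "n mod d = 0" using least d by (metis mod_less_divisor neq0_conv)
  then have "d dvd n" by auto
  moreover have "z \<in> primitive_unity_roots d"
    using d least by (auto simp: primitive_unity_roots_def)
  ultimately show "z \<in> (\<Union>d\<in>{d. d dvd n}. primitive_unity_roots d)" by blast
next
  fix z assume "z \<in> (\<Union>d\<in>{d. d dvd n}. primitive_unity_roots d)"
  then show "z \<in> {z. z ^ n = 1}"
    by (auto simp: primitive_unity_roots_def power_mult elim!: dvdE)
qed

lemma primitive_unity_roots_disjoint:
  "0 < d \<Longrightarrow> 0 < e \<Longrightarrow> d \<noteq> e \<Longrightarrow> primitive_unity_roots d \<inter> primitive_unity_roots e = {}"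
  by (auto simp: primitive_unity_roots_def) (metis linorder_neqE_nat)

lemma prod_unity_roots:
  assumes n: "n > 0"
  shows "(\<Prod>z\<in>{z::complex. z ^ n = 1}. [:- z, 1:]) = monom 1 n - 1"
proof -
  let ?p = "monom 1 n - 1 :: complex poly"
  let ?R = "{z::complex. z ^ n = 1}"
  let ?P = "\<Prod>z\<in>?R. [:- z, 1:]"
  have fin: "finite ?R" using n by (intro finite_roots_unity) simp
  have card: "card ?R = n" using card_roots_unity_eq n by blast
  have degP: "degree ?P = n"
    by (subst degree_prod_sum_eq) (use card in auto)
  have lcP: "coeff ?P n = 1"
    using lead_coeff_prod[of "\<lambda>z. [:- z, 1:]" ?R] degP by simp
  have "?p - ?P = 0"
  proof (rule ccontr)
    assume nz: "?p - ?P \<noteq> 0"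
    have dle: "degree (?p - ?P) \<le> n"
      by (rule degree_diff_le) (use degP in \<open>auto intro!: degree_diff_le simp: degree_monom_le\<close>)
    have "coeff (?p - ?P) n = 0" using lcP n by simp
    then have dlt: "degree (?p - ?P) < n"
      using dle nz by (metis le_neq_implies_less leading_coeff_0_iff)
    have "?R \<subseteq> {z. poly (?p - ?P) z = 0}"
      using fin by (auto simp: poly_prod poly_monom)
    then have "card ?R \<le> card {z. poly (?p - ?P) z = 0}"
      by (intro card_mono poly_roots_finite nz)
    also have "\<dots> \<le> degree (?p - ?P)"
      by (rule card_poly_roots_bound[OF nz])
    finally show False using dlt card by simp
  qed
  then show ?thesis by simp
qed

lemma prod_complex_cyclotomic:
  assumes n: "n > 0"
  shows "(\<Prod>d | d dvd n. complex_cyclotomic d) = monom 1 n - 1"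
proof -
  have pos: "0 < d" if "d dvd n" for d using n that by (auto intro: Nat.gr0I)
  have "(\<Prod>z\<in>{z::complex. z ^ n = 1}. [:- z, 1:]) = (\<Prod>d | d dvd n. complex_cyclotomic d)"
    unfolding unity_roots_decomp[OF n] complex_cyclotomic_def
    by (rule prod.UNION_disjoint)
      (use n pos finite_primitive_unity_roots primitive_unity_roots_disjoint in auto)
  then show ?thesis using prod_unity_roots[OF n] by simp
qed

lemma complex_cyclotomic_integral: "n > 0 \<Longrightarrow> \<exists>p. map_poly of_int p = complex_cyclotomic n"
proof (induction n rule: less_induct)
  case (less n)
  let ?h = "map_poly of_int :: int poly \<Rightarrow> complex poly"
  let ?D = "{d. d dvd n} - {n}"
  have D: "0 < d \<and> d < n" if "d \<in> ?D" for d
    using less.prems that dvd_imp_le[of d n] by (auto intro: Nat.gr0I)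
  then obtain c where c: "?h (c d) = complex_cyclotomic d" if "d \<in> ?D" for d
    using less.IH by metis
  define q where "q = (\<Prod>d\<in>?D. c d)"
  have h_prod: "?h (prod f A) = (\<Prod>d\<in>A. ?h (f d))" for f :: "nat \<Rightarrow> int poly" and A
    by (induction A rule: infinite_finite_induct) (auto simp: of_int_poly_mult)
  have hq: "?h q = (\<Prod>d\<in>?D. complex_cyclotomic d)"
    unfolding q_def h_prod by (rule prod.cong) (use c in auto)
  then have "lead_coeff (?h q) = 1"
    by (simp add: lead_coeff_prod monic_complex_cyclotomic)
  then have lq: "lead_coeff q = 1"
    by (simp add: degree_of_int_poly coeff_map_poly)
  have "?h q * complex_cyclotomic n = monom 1 n - 1"
    using prod_complex_cyclotomic[OF less.prems] less.prems
    by (subst (asm) prod.remove[of _ n]) (auto simp: hq mult.commute)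
  also have "\<dots> = ?h (monom 1 n - 1)"
    by (rule poly_eqI) (auto simp: coeff_map_poly)
  finally show ?case by (rule int_quotient[OF lq])
qed

lemma of_int_poly_cyclotomic:
  assumes "n > 0"
  shows "map_poly of_int (cyclotomic n) = complex_cyclotomic n"
  unfolding cyclotomic_def
  by (rule theI') (use complex_cyclotomic_integral[OF assms] of_int_poly_inj in metis)

end

theory Submission
  imports Defs "HOL-Number_Theory.Totient" "HOL-Analysis.Infinite_Products"
begin

text \<open>
  Put \<open>y = 1 / x < 1/2\<close> and write \<open>\<Phi>\<^sub>n(x) = x\<^bsup>\<phi>(n)\<^esup> exp (L\<^sub>n(y))\<close>. The divisor sum of \<open>L\<close> at \<open>n\<close> is
  \<open>ln (1 - y\<^sup>n)\<close>, so \<open>L\<^sub>n(y)\<close> is a combination of the \<open>ln (1 - z\<^sup>d)\<close> with \<open>z = y\<^sup>s\<close>, \<open>n = s k\<close>, \<open>d\<close> dividing \<open>k\<close>,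
  with coefficients bounded by 1 and coefficient \<open>\<plusminus>1\<close> at \<open>d = 1\<close> (here \<open>k\<close> is the radical of \<open>n\<close>).
  Hence \<open>L\<^sub>n(y) = \<plusminus>ln (1 - z)\<close> up to a small error.

  Let \<open>q = p\<^bsup>i-1\<^esup>\<close>. Then \<open>L\<close> at \<open>p\<^sup>i\<close> and \<open>2p\<^sup>i\<close> is bounded by \<open>-ln (1 - y\<^sup>q)\<close> in absolute value. If \<open>\<phi>(n) \<noteq> \<phi>(p\<^sup>i)\<close>,
  the two totients differ by at least 2, and the factor \<open>x\<^sup>2 > 4\<close> outweighs everything else. If \<open>\<phi>(n) = \<phi>(p\<^sup>i)\<close>
  and \<open>p\<close> divides \<open>n\<close>, then \<open>n\<close> is \<open>p\<^sup>i\<close> or \<open>2p\<^sup>i\<close>. If \<open>p\<close> does not divide \<open>n\<close>, then \<open>s\<close> is a proper divisor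
  of \<open>p - 1\<close>, so \<open>2 s < q\<close> and \<open>y\<^sup>q\<close> is too small compared with \<open>z\<close> for \<open>L\<^sub>n(y)\<close> to lie between the other two.
\<close>

section \<open>Cyclotomic values at real points\<close>

definition cyclotomic_at :: "nat \<Rightarrow> real \<Rightarrow> real" where
  "cyclotomic_at n x = poly (map_poly of_int (cyclotomic n)) x"

lemma poly_of_int_poly_prod:
  "poly (map_poly of_int (prod f A)) x = (\<Prod>a\<in>A. poly (map_poly of_int (f a)) (x :: real))"
proof (induction A rule: infinite_finite_induct)
  case (insert a A)
  have "map_poly of_int (f a * prod f A) = (map_poly of_int (f a) * map_poly of_int (prod f A) :: real poly)"
    by (rule poly_eqI) (simp add: coeff_map_poly coeff_mult)
  with insert show ?case by simp
qed auto

text \<open>The embedding of integer into complex polynomials is injective, so the complex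
  factorization descends to the integers, whence it can be evaluated at real points.\<close>

lemma prod_cyclotomic:
  assumes "n > 0"
  shows "(\<Prod>d | d dvd n. cyclotomic d) = monom 1 n - 1"
proof (rule of_int_poly_inj)
  let ?h = "map_poly of_int :: int poly \<Rightarrow> complex poly"
  have "?h (prod f A) = (\<Prod>d\<in>A. ?h (f d))" for f :: "nat \<Rightarrow> int poly" and A
    by (induction A rule: infinite_finite_induct) (auto simp: of_int_poly_mult)
  moreover have "(\<Prod>d | d dvd n. ?h (cyclotomic d)) = (\<Prod>d | d dvd n. complex_cyclotomic d)"
    by (rule prod.cong) (use assms in \<open>auto intro!: of_int_poly_cyclotomic intro: Nat.gr0I\<close>)
  moreover have "monom 1 n - 1 = ?h (monom 1 n - 1)"
    by (rule poly_eqI) (auto simp: coeff_map_poly)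
  ultimately show "?h (\<Prod>d | d dvd n. cyclotomic d) = ?h (monom 1 n - 1)"
    using prod_complex_cyclotomic[OF assms] by simp
qed

lemma prod_cyclotomic_at:
  assumes "n > 0"
  shows "(\<Prod>d | d dvd n. cyclotomic_at d x) = x ^ n - 1"
proof -
  have "map_poly of_int (monom 1 n - 1) = (monom 1 n - 1 :: real poly)"
    by (rule poly_eqI) (auto simp: coeff_map_poly)
  then show ?thesis
    using poly_of_int_poly_prod[of cyclotomic "{d. d dvd n}" x]
    by (simp add: prod_cyclotomic[OF assms] cyclotomic_at_def poly_monom)
qed

text \<open>By strong induction the product over the proper divisors is positive, and so is
  \<open>x ^ n - 1\<close>; hence the remaining factor is positive.\<close>

lemma cyclotomic_at_pos:
  assumes "n > 0" "x > 1"
  shows "cyclotomic_at n x > 0"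
  using assms(1)
proof (induction n rule: less_induct)
  case (less n)
  let ?P = "\<Prod>d\<in>{d. d dvd n} - {n}. cyclotomic_at d x"
  have "?P > 0"
  proof (rule prod_pos)
    fix d assume "d \<in> {d. d dvd n} - {n}"
    then have "d < n" "d > 0"
      using less.prems dvd_imp_le[of d n] by (auto intro: Nat.gr0I)
    then show "cyclotomic_at d x > 0" by (rule less.IH)
  qed
  moreover have "cyclotomic_at n x * ?P = x ^ n - 1"
    using prod_cyclotomic_at[OF less.prems, of x] less.prems
    by (subst (asm) prod.remove[of _ n]) auto
  moreover have "x ^ n > 1" using assms less.prems by simp
  ultimately show ?case by (metis diff_gt_0_iff_gt zero_less_mult_pos2)
qed

section \<open>The logarithmic factor and its expansion\<close>

definition log_cyclotomic :: "nat \<Rightarrow> real \<Rightarrow> real" where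
  "log_cyclotomic n y = ln (cyclotomic_at n (1 / y) * y ^ totient n)"

lemma cyclotomic_at_eq_exp:
  assumes "n > 0" "x > 1"
  shows "cyclotomic_at n x = x ^ totient n * exp (log_cyclotomic n (1 / x))"
  using assms cyclotomic_at_pos[OF assms]
  by (simp add: log_cyclotomic_def power_one_over field_simps)

text \<open>The totients of the divisors of \<open>n\<close> add up to \<open>n\<close>, so the
  powers of \<open>y\<close> combine to \<open>y ^ n\<close> and turn \<open>(1 / y) ^ n - 1\<close>
  into \<open>1 - y ^ n\<close>.\<close>

lemma sum_log_cyclotomic:
  assumes "n > 0" "0 < y" "y < 1"
  shows "(\<Sum>d | d dvd n. log_cyclotomic d y) = ln (1 - y ^ n)"
proof -
  have pos: "cyclotomic_at d (1 / y) * y ^ totient d > 0" if "d dvd n" for d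
    using that assms by (auto intro!: mult_pos_pos cyclotomic_at_pos intro: Nat.gr0I)
  have "(\<Sum>d | d dvd n. log_cyclotomic d y) = ln (\<Prod>d | d dvd n. cyclotomic_at d (1 / y) * y ^ totient d)"
    unfolding log_cyclotomic_def by (rule ln_prod[symmetric]) (use assms in \<open>auto dest!: pos\<close>)
  also have "(\<Prod>d | d dvd n. cyclotomic_at d (1 / y) * y ^ totient d) = ((1 / y) ^ n - 1) * y ^ n"
    using assms by (simp add: prod.distrib prod_cyclotomic_at power_sum[symmetric] totient_divisor_sum)
  also have "\<dots> = 1 - y ^ n"
    using assms by (simp add: power_one_over field_simps)
  finally show ?thesis .
qed

text \<open>The uniqueness half of Moebius inversion: a function on the positive integers is
  recovered recursively from its divisor sums.\<close>

lemma sum_divisors_inject: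
  fixes f g :: "nat \<Rightarrow> 'a :: cancel_comm_monoid_add"
  assumes "\<And>n. n > 0 \<Longrightarrow> (\<Sum>d | d dvd n. f d) = (\<Sum>d | d dvd n. g d)" and "n > 0"
  shows "f n = g n"
  using assms(2)
proof (induction n rule: less_induct)
  case (less n)
  have "f d = g d" if "d \<in> {d. d dvd n} - {n}" for d
    using that less.prems dvd_imp_le[of d n] by (intro less.IH) (auto intro: Nat.gr0I)
  then have "(\<Sum>d\<in>{d. d dvd n} - {n}. f d) = (\<Sum>d\<in>{d. d dvd n} - {n}. g d)"
    by (rule sum.cong[OF refl])
  then show ?case
    using assms(1)[OF less.prems] less.prems
    by (simp add: sum.remove[of "{d. d dvd n}" n])
qed

lemma divisors_mult_prime:
  fixes p m :: nat
  assumes "prime p"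
  shows "{d. d dvd p * m} = (\<lambda>d. p * d) ` {d. d dvd m} \<union> {d. d dvd m \<and> \<not> p dvd d}"
proof (intro equalityI subsetI)
  fix d assume d: "d \<in> {d. d dvd p * m}"
  show "d \<in> (\<lambda>d. p * d) ` {d. d dvd m} \<union> {d. d dvd m \<and> \<not> p dvd d}"
  proof (cases "p dvd d")
    case True
    then obtain e where "d = p * e" by (elim dvdE)
    with d assms show ?thesis by auto
  next
    case False
    then have "coprime d p" using assms by (metis coprime_commute prime_imp_coprime)
    with d False show ?thesis by (simp add: coprime_dvd_mult_right_iff)
  qed
qed auto

text \<open>Logarithmic form of the classical rule that \<open>\<Phi>\<^sub>p\<^sub>n(x)\<close> is
  \<open>\<Phi>\<^sub>n(x\<^sup>p)\<close>, divided by \<open>\<Phi>\<^sub>n(x)\<close> when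
  \<open>p\<close> does not divide \<open>n\<close>. After rearrangement both sides have the same
  divisor sums.\<close>

lemma log_cyclotomic_mult_prime:
  assumes p: "prime p" and n: "n > 0" and y: "0 < y" "y < 1"
  shows "log_cyclotomic (p * n) y =
    log_cyclotomic n (y ^ p) - (if p dvd n then 0 else log_cyclotomic n y)"
proof -
  have p0: "p > 0" using p by (simp add: prime_gt_0_nat)
  let ?g = "\<lambda>m. if p dvd m then 0 else log_cyclotomic m y"
  \<comment> \<open>Setting \<open>?g\<close> to 0 at multiples of \<open>p\<close> lets the
    divisors of \<open>p * m\<close> prime to \<open>p\<close> be summed over all divisors of
    \<open>m\<close>.\<close>
  have "(\<Sum>d | d dvd m. log_cyclotomic (p * d) y + ?g d) = (\<Sum>d | d dvd m. log_cyclotomic d (y ^ p))"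
    if m: "m > 0" for m
  proof -
    have fin: "finite {d. d dvd p * m}" using m p0 by simp
    have split: "{d. d dvd p * m} = (\<lambda>d. p * d) ` {d. d dvd m} \<union> {d. d dvd m \<and> \<not> p dvd d}"
      by (rule divisors_mult_prime[OF p])
    have "ln (1 - y ^ (p * m)) = (\<Sum>d | d dvd p * m. log_cyclotomic d y)"
      using sum_log_cyclotomic[of "p * m" y] m p0 y by simp
    also have "\<dots> = (\<Sum>d\<in>(\<lambda>d. p * d) ` {d. d dvd m}. log_cyclotomic d y)
        + (\<Sum>d | d dvd m \<and> \<not> p dvd d. log_cyclotomic d y)"
      unfolding split by (rule sum.union_disjoint) (use fin m in auto)
    also have "(\<Sum>d\<in>(\<lambda>d. p * d) ` {d. d dvd m}. log_cyclotomic d y)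
        = (\<Sum>d | d dvd m. log_cyclotomic (p * d) y)"
      by (subst sum.reindex) (use p0 in \<open>auto simp: inj_on_def\<close>)
    also have "(\<Sum>d | d dvd m \<and> \<not> p dvd d. log_cyclotomic d y) = (\<Sum>d | d dvd m. ?g d)"
      using m by (intro sum.mono_neutral_cong_left) auto
    finally show ?thesis
      using sum_log_cyclotomic[of m "y ^ p"] m y p0
      by (simp add: sum.distrib power_mult power_less_one_iff)
  qed
  from sum_divisors_inject[OF this n] show ?thesis by (simp add: algebra_simps)
qed

text \<open>Induction on the prime factors: a repeated prime only enlarges \<open>s\<close>; a new
  prime enlarges \<open>k\<close> and adds a copy of the sum with opposite signs. On the divisors of
  \<open>k\<close> this makes \<open>c d\<close> the Moebius value at
  \<open>k div d\<close>.\<close>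

lemma log_cyclotomic_representation:
  assumes "n > 0"
  obtains s k :: nat and c :: "nat \<Rightarrow> real" where
    "n = s * k" "totient n = s * totient k" "\<bar>c 1\<bar> = 1" "\<And>d. \<bar>c d\<bar> \<le> 1"
    "\<And>y. 0 < y \<Longrightarrow> y < 1 \<Longrightarrow> log_cyclotomic n y = (\<Sum>d | d dvd k. c d * ln (1 - (y ^ s) ^ d))"
proof -
  let ?R = "\<lambda>n s k (c :: nat \<Rightarrow> real). n = s * k \<and> totient n = s * totient k
      \<and> \<bar>c 1\<bar> = 1 \<and> (\<forall>d. \<bar>c d\<bar> \<le> 1) \<and>
      (\<forall>y. 0 < y \<and> y < 1 \<longrightarrow> log_cyclotomic n y = (\<Sum>d | d dvd k. c d * ln (1 - (y ^ s) ^ d)))"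
  have "\<exists>s k c. ?R n s k c"
    using assms
  proof (induction n rule: prime_divisors_induct)
    case (unit n)
    then have n: "n = 1" by simp
    have "log_cyclotomic 1 y = ln (1 - y)" if "0 < y" "y < 1" for y
      using sum_log_cyclotomic[of 1 y] that by simp
    then show ?case
      by (intro exI[of _ 1] exI[of _ "\<lambda>_. 1"]) (simp add: n)
  next
    case (factor p n)
    from factor.prems have n: "n > 0" by simp
    have p0: "p > 0" using factor.hyps by (simp add: prime_gt_0_nat)
    from factor.IH[OF n] obtain s where "\<exists>k c. ?R n s k c" ..
    then obtain k where "\<exists>c. ?R n s k c" ..
    then obtain c where R: "?R n s k c" ..
    from R have nk: "n = s * k" by (elim conjE)
    from R have tot: "totient n = s * totient k" by (elim conjE)
    from R have c: "\<bar>c 1\<bar> = 1 \<and> (\<forall>d. \<bar>c d\<bar> \<le> 1)" by (elim conjE, intro conjI)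
    from R have L: "log_cyclotomic n y = (\<Sum>d | d dvd k. c d * ln (1 - (y ^ s) ^ d))" if "0 < y" "y < 1" for y
      by (elim conjE) (use that in simp)
    have k: "k > 0" using n nk by (auto intro: Nat.gr0I)
    have yp: "0 < y ^ p \<and> y ^ p < 1" if "0 < y" "y < 1" for y :: real
      using that p0 by (simp add: power_less_one_iff)
    show ?case
    proof (cases "p dvd n")
      case True
      have "gcd p n = p" using True by (simp add: gcd_nat.absorb1)
      then have tp: "totient (p * n) = p * totient n"
        using totient_gcd[of p n] p0 by simp
      have "log_cyclotomic (p * n) y = (\<Sum>d | d dvd k. c d * ln (1 - (y ^ (p * s)) ^ d))"
        if "0 < y" "y < 1" for y
        using log_cyclotomic_mult_prime[OF factor.hyps n that] True L[of "y ^ p"] yp[OF that]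
        by (simp add: power_mult)
      moreover have "p * n = p * s * k" "totient (p * n) = p * s * totient k"
        using nk tp tot by simp_all
      ultimately have "?R (p * n) (p * s) k c"
        using c by blast
      then show ?thesis by blast
    next
      case False
      have pk: "\<not> p dvd k" using False nk by auto
      then have cop: "coprime p k" "coprime p n"
        using False factor.hyps by (auto intro: prime_imp_coprime)
      define c' where "c' d = (if p dvd d then c (d div p) else - c d)" for d
      have split: "{d. d dvd p * k} = (\<lambda>d. p * d) ` {d. d dvd k} \<union> {d. d dvd k}"
        using divisors_mult_prime[OF factor.hyps, of k] pk by (auto dest: dvd_trans)
      have "log_cyclotomic (p * n) y = (\<Sum>d | d dvd p * k. c' d * ln (1 - (y ^ s) ^ d))"
        if y: "0 < y" "y < 1" for y
      proof -
        have "(\<Sum>d | d dvd p * k. c' d * ln (1 - (y ^ s) ^ d))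
          = (\<Sum>d\<in>(\<lambda>d. p * d) ` {d. d dvd k}. c' d * ln (1 - (y ^ s) ^ d))
            + (\<Sum>d | d dvd k. c' d * ln (1 - (y ^ s) ^ d))"
          unfolding split by (rule sum.union_disjoint) (use k pk in \<open>auto intro: dvd_trans\<close>)
        also have "(\<Sum>d\<in>(\<lambda>d. p * d) ` {d. d dvd k}. c' d * ln (1 - (y ^ s) ^ d))
          = (\<Sum>d | d dvd k. c d * ln (1 - ((y ^ p) ^ s) ^ d))"
          by (subst sum.reindex)
            (use p0 in \<open>auto simp: inj_on_def c'_def mult_ac simp flip: power_mult intro!: sum.cong\<close>)
        also have "(\<Sum>d | d dvd k. c' d * ln (1 - (y ^ s) ^ d)) = - (\<Sum>d | d dvd k. c d * ln (1 - (y ^ s) ^ d))"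
          unfolding sum_negf[symmetric]
          by (rule sum.cong) (use pk in \<open>auto simp: c'_def dest: dvd_trans\<close>)
        finally show ?thesis
          using log_cyclotomic_mult_prime[OF factor.hyps n y] False L[of "y ^ p"] L[of y] yp[OF y] y
          by simp
      qed
      moreover have "totient (p * n) = s * totient (p * k)"
        using cop by (simp add: totient_mult_coprime tot)
      moreover have "p * n = s * (p * k)" using nk by simp
      moreover have "\<bar>c' 1\<bar> = 1" "\<forall>d. \<bar>c' d\<bar> \<le> 1"
        using c factor.hyps by (auto simp: c'_def prime_nat_iff)
      ultimately have "?R (p * n) s (p * k) c'"
        by blast
      then show ?thesis by blast
    qed
  qed simp
  then show ?thesis using that by metis
qed

section \<open>Bounding the deviation from the leading term\<close>

text \<open>
  A lower bound for \<open>\<Prod>d\<ge>2. (1 - z ^ d)\<close>: the factors with \<open>d \<ge> 4\<close> are replaced by \<open>1 - (\<Sum>d\<ge>4. z ^ d)\<close>. Both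
  estimates below are nearly sharp at \<open>z = 1/2\<close>, so the factors for \<open>d = 2, 3\<close> cannot be merged into the sum.
\<close>
definition tail_bound :: "real \<Rightarrow> real" where
  "tail_bound z = (1 - z ^ 2) * (1 - z ^ 3) * (1 - z ^ 4 / (1 - z))"

lemma tail_bound_pos:
  assumes "0 < z" "z < 1/2"
  shows "tail_bound z > 0"
proof -
  have "z ^ 4 < (1/2) ^ 4" using assms by (intro power_strict_mono) auto
  then have "z ^ 4 / (1 - z) < 1" using assms by (simp add: power_one_over)
  moreover have "z ^ 2 < 1" "z ^ 3 < 1" using assms by (simp_all add: power_less_one_iff)
  ultimately show ?thesis unfolding tail_bound_def by simp
qed

text \<open>The Weierstrass inequality bounds the product from \<open>d = 4\<close> on by one minus
  a geometric sum. The upper limit \<open>m + 4\<close> guarantees that the factors for 2 and 3 are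
  present to be split off.\<close>

lemma prod_one_minus_power_ge:
  assumes z: "0 < z" "z < 1/2"
  shows "tail_bound z \<le> (\<Prod>d = 2..m + 4. 1 - z ^ d)"
proof -
  have "1 - z ^ 4 / (1 - z) \<le> 1 - (\<Sum>d = 4..m + 4. z ^ d)"
    using z by (subst sum_gp) (simp add: divide_right_mono)
  also have "\<dots> \<le> (\<Prod>d = 4..m + 4. 1 - z ^ d)"
    using z by (intro Weierstrass_prod_ineq) (auto intro: power_le_one)
  finally have "(1 - z ^ 2) * (1 - z ^ 3) * (1 - z ^ 4 / (1 - z))
      \<le> (1 - z ^ 2) * (1 - z ^ 3) * (\<Prod>d = 4..m + 4. 1 - z ^ d)"
    using z by (intro mult_left_mono) (auto intro!: mult_nonneg_nonneg simp: power_le_one)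
  also have "\<dots> = (\<Prod>d = 2..m + 4. 1 - z ^ d)"
    using prod.atLeast_Suc_atMost[of 2 "m + 4" "\<lambda>d. 1 - z ^ d"]
      prod.atLeast_Suc_atMost[of 3 "m + 4" "\<lambda>d. 1 - z ^ d"]
    by (simp add: mult.assoc)
  finally show ?thesis unfolding tail_bound_def .
qed

text \<open>All the logarithms are negative, so enlarging \<open>D\<close> to a full interval
  starting at 2 only lowers the sum.\<close>

lemma sum_ln_one_minus_power_ge:
  assumes z: "0 < z" "z < 1/2" and D: "finite D" "D \<subseteq> {2..}"
  shows "ln (tail_bound z) \<le> (\<Sum>d\<in>D. ln (1 - z ^ d))"
proof -
  have less: "0 < 1 - z ^ d" "1 - z ^ d < 1" if "d > 0" for d
    using z that by (simp_all add: power_less_one_iff)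
  have ne: "z ^ d \<noteq> 1" if "d \<ge> 2" for d
    using less(1)[of d] that by auto
  obtain m where m: "D \<subseteq> {..m}" using D(1) finite_nat_set_iff_bounded_le by auto
  have "ln (tail_bound z) \<le> ln (\<Prod>d = 2..m + 4. 1 - z ^ d)"
    using prod_one_minus_power_ge[OF z] tail_bound_pos[OF z] by (rule ln_mono[rotated 2, OF _ _])
  also have "\<dots> = (\<Sum>d = 2..m + 4. ln (1 - z ^ d))"
    by (rule ln_prod) (use ne in auto)
  also have "\<dots> \<le> (\<Sum>d\<in>D. ln (1 - z ^ d))"
  proof -
    have "- (\<Sum>d\<in>D. - ln (1 - z ^ d)) \<ge> - (\<Sum>d = 2..m + 4. - ln (1 - z ^ d))"
      unfolding neg_le_iff_le
    proof (intro sum_mono2)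
      show "D \<subseteq> {2..m + 4}" using D(2) m by force
      fix d assume "d \<in> {2..m + 4} - D"
      then show "0 \<le> - ln (1 - z ^ d)" using less[of d] by simp
    qed auto
    then show ?thesis by (simp add: sum_negf)
  qed
  finally show ?thesis .
qed

text \<open>The divisor \<open>d = 1\<close> gives the main term with sign \<open>e = c 1\<close>;
  the other coefficients are at most 1 in absolute value, so the tail bound controls the
  rest.\<close>

lemma log_cyclotomic_estimate:
  assumes "n > 0"
  obtains s k :: nat and e :: real where "n = s * k" "totient n = s * totient k" "\<bar>e\<bar> = 1"
    "\<And>y. 0 < y \<Longrightarrow> y < 1/2 \<Longrightarrow>
      \<bar>log_cyclotomic n y - e * ln (1 - y ^ s)\<bar> \<le> - ln (tail_bound (y ^ s))"
proof -
  from assms obtain s k and c :: "nat \<Rightarrow> real" where nk: "n = s * k" and tot: "totient n = s * totient k"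
    and c: "\<bar>c 1\<bar> = 1" "\<And>d. \<bar>c d\<bar> \<le> 1"
    and L: "\<And>y. 0 < y \<Longrightarrow> y < 1 \<Longrightarrow> log_cyclotomic n y = (\<Sum>d | d dvd k. c d * ln (1 - (y ^ s) ^ d))"
    using log_cyclotomic_representation by blast
  have k: "k > 0" and s: "s > 0" using assms nk by (auto intro: Nat.gr0I)
  show thesis
  proof (rule that[OF nk tot c(1)])
    fix y :: real assume y: "0 < y" "y < 1/2"
    define z where "z = y ^ s"
    have "y ^ s \<le> y ^ 1" using y s by (intro power_decreasing) auto
    then have z: "0 < z" "z < 1/2" using y by (auto simp: z_def)
    let ?D = "{d. d dvd k} - {1}"
    have D: "finite ?D" "?D \<subseteq> {2..}"
    proof -
      have "d \<noteq> 0" if "d dvd k" for d using k that by auto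
      then show "?D \<subseteq> {2..}" by (force simp: not_less_eq_eq[symmetric] numeral_2_eq_2)
    qed (use k in simp)
    have "\<bar>\<Sum>d\<in>?D. c d * ln (1 - z ^ d)\<bar> \<le> (\<Sum>d\<in>?D. \<bar>c d * ln (1 - z ^ d)\<bar>)" by (rule sum_abs)
    also have "\<dots> \<le> (\<Sum>d\<in>?D. - ln (1 - z ^ d))"
    proof (rule sum_mono)
      fix d assume "d \<in> ?D"
      then have "d > 0" using k by (auto intro: Nat.gr0I)
      then have "z ^ d < 1" using z by (simp add: power_less_one_iff)
      then have "ln (1 - z ^ d) \<le> 0" using z by simp
      then show "\<bar>c d * ln (1 - z ^ d)\<bar> \<le> - ln (1 - z ^ d)"
        using mult_right_mono[OF c(2)[of d], of "\<bar>ln (1 - z ^ d)\<bar>"] by (simp add: abs_mult)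
    qed
    also have "\<dots> \<le> - ln (tail_bound z)"
      using sum_ln_one_minus_power_ge[OF z D] by (simp add: sum_negf)
    finally have bound: "\<bar>\<Sum>d\<in>?D. c d * ln (1 - z ^ d)\<bar> \<le> - ln (tail_bound z)" .
    have "log_cyclotomic n y = (\<Sum>d | d dvd k. c d * ln (1 - z ^ d))"
      using L y by (simp add: z_def)
    also have "\<dots> = c 1 * ln (1 - z) + (\<Sum>d\<in>?D. c d * ln (1 - z ^ d))"
      using k by (subst sum.remove[of _ 1]) auto
    finally show "\<bar>log_cyclotomic n y - c 1 * ln (1 - y ^ s)\<bar> \<le> - ln (tail_bound (y ^ s))"
      unfolding z_def[symmetric] using bound by simp
  qed
qed

lemma tail_bound_coarse:
  assumes z: "0 < z" "z < 1/2"
  shows "2 / 7 < (1 - z) * tail_bound z"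
proof -
  have z': "z ^ 2 \<le> (1/2) ^ 2" "z ^ 3 \<le> (1/2) ^ 3" "z ^ 4 \<le> (1/2) ^ 4"
    using z by (auto intro!: power_mono)
  \<comment> \<open>All three factors of \<open>(1 - z ^ 2) * (1 - z ^ 3) * (1 - z - z ^ 4)\<close>
    decrease in \<open>z\<close>; these are their values at 1/2, with
    \<open>7/16 = 1 - 1/2 - 1/16\<close>.\<close>
  have "2 / 7 < (1 - (1/2)\<^sup>2) * (1 - (1/2) ^ 3) * (7/16 :: real)"
    by (simp add: power_one_over)
  also have "\<dots> \<le> (1 - z ^ 2) * (1 - z ^ 3) * (1 - z - z ^ 4)"
    using z z' by (intro mult_mono mult_nonneg_nonneg) (auto simp: power_one_over)
  also have "\<dots> = (1 - z) * tail_bound z"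
    using z by (simp add: tail_bound_def field_simps)
  finally show ?thesis .
qed

text \<open>After division by \<open>1 - z\<close>, the quantities \<open>z ^ 3\<close>,
  \<open>z ^ 4 / (1 - z)\<close> and \<open>z ^ 2 / 2\<close> are all at most
  \<open>u = z / 4\<close>, with equality at \<open>z = 1/2\<close>. It remains that
  \<open>(1 + 4 * u) * (1 - u) ^ 3\<close> exceeds 1.\<close>

lemma tail_bound_fine:
  assumes z: "0 < z" "z < 1/2"
  shows "1 - z < tail_bound z * (1 - z ^ 2 / 2)"
proof -
  define u where "u = z / 4"
  have u: "0 < u" "u < 1/8" using z by (auto simp: u_def)
  have z2: "z ^ 2 \<le> z / 2" using z by (simp add: power2_eq_square)
  have z3: "z ^ 3 \<le> z / 4" 
    using mult_mono[OF z2, of z "1/2"] z by (simp add: power3_eq_cube power2_eq_square)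
  have z4: "z ^ 4 \<le> z / 8"
    using mult_mono[OF z3, of z "1/2"] z by (simp add: power3_eq_cube power4_eq_xxxx)
  have "z ^ 4 \<le> (z / 4) * (1 - z)" using z4 z mult_left_mono[of "1/2" "1 - z" "z / 4"] by linarith
  then have z4': "z ^ 4 / (1 - z) \<le> u" using z by (simp add: u_def divide_le_eq)
  \<comment> \<open>This is \<open>(1 + 4 * u) * (1 - u) ^ 3 - 1\<close>, grouped so that positivity
    is visible for \<open>u < 1/8\<close>.\<close>
  have "0 < u * ((1 - 8 * u) * (1 - u) + 3 * u\<^sup>2 - 4 * u ^ 3)"
  proof -
    have "0 < (1 - 8 * u) * (1 - u)" "0 < u\<^sup>2 * (3 - 4 * u)" using u by simp_all
    moreover have "u\<^sup>2 * (3 - 4 * u) = 3 * u\<^sup>2 - 4 * u ^ 3"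
      by (simp add: power2_eq_square power3_eq_cube algebra_simps)
    ultimately show ?thesis using u by (intro mult_pos_pos) linarith+
  qed
  also have "\<dots> = (1 + 4 * u) * ((1 - u) * (1 - u) * (1 - u)) - 1"
    by (simp add: power2_eq_square power3_eq_cube algebra_simps)
  finally have "1 < (1 + z) * ((1 - u) * (1 - u) * (1 - u))"
    by (simp add: u_def)
  then have "1 - z < (1 - z) * ((1 + z) * ((1 - u) * (1 - u) * (1 - u)))"
    using mult_strict_left_mono[of 1 _ "1 - z"] z by simp
  also have "\<dots> \<le> (1 - z) * ((1 + z) * ((1 - z ^ 3) * (1 - z ^ 4 / (1 - z)) * (1 - z ^ 2 / 2)))"
  proof -
    have le: "(1 - u) * (1 - u) \<le> (1 - z ^ 3) * (1 - z ^ 4 / (1 - z))"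
      using u z3 z4' by (intro mult_mono) (simp_all add: u_def)
    have "(1 - u) * (1 - u) * (1 - u) \<le> (1 - z ^ 3) * (1 - z ^ 4 / (1 - z)) * (1 - z ^ 2 / 2)"
    proof (rule mult_mono[OF le])
      show "1 - u \<le> 1 - z ^ 2 / 2" using z2 by (simp add: u_def)
      show "0 \<le> (1 - z ^ 3) * (1 - z ^ 4 / (1 - z))" by (rule order_trans[OF zero_le_square le])
    qed (use u in simp)
    then show ?thesis using z by (intro mult_left_mono) simp_all
  qed
  also have "\<dots> = tail_bound z * (1 - z ^ 2 / 2)"
  proof -
    have "1 - z ^ 2 = (1 - z) * (1 + z)" by (simp add: power2_eq_square algebra_simps)
    then show ?thesis by (simp only: tail_bound_def mult.assoc)
  qed
  finally show ?thesis .
qed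

section \<open>Prime powers and their doubles\<close>

text \<open>The divisors of \<open>p ^ i\<close> are \<open>p ^ i\<close> and the divisors of
  \<open>p ^ (i - 1)\<close>, so the difference of two divisor sums leaves one term.\<close>

lemma log_cyclotomic_prime_power:
  assumes p: "prime p" and i: "i > 0" and y: "0 < y" "y < 1"
  shows "log_cyclotomic (p ^ i) y = ln (1 - y ^ p ^ i) - ln (1 - y ^ p ^ (i - 1))"
proof -
  obtain j where j: "i = Suc j" using i by (cases i) auto
  have p0: "p > 1" using p prime_gt_1_nat by blast
  have "{d. d dvd p ^ i} = insert (p ^ i) {d. d dvd p ^ j}"
    unfolding j divides_primepow_nat[OF p] by (auto simp: le_Suc_eq)
  moreover have "\<not> p ^ i dvd p ^ j" using p0 by (simp add: j power_dvd_imp_le power_gt1 nat_dvd_not_less)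
  ultimately show ?thesis
    using sum_log_cyclotomic[of "p ^ i" y] sum_log_cyclotomic[of "p ^ j" y] p0 y by (simp add: j)
qed

text \<open>With \<open>v = y ^ p ^ i\<close>, the two values are the logarithms of
  \<open>(1 - v) / (1 - t)\<close> and \<open>(1 + v) / (1 + t)\<close>. The bounds follow from
  \<open>0 < v < t < 1\<close> and \<open>(1 - t) * (1 + t) < 1\<close>.\<close>

lemma prime_power_bounds:
  assumes p: "prime p" "odd p" and i: "i > 0" and y: "0 < y" "y < 1/2"
  defines "t \<equiv> y ^ p ^ (i - 1)"
  shows "log_cyclotomic (p ^ i) y < - ln (1 - t)"
    and "ln (1 - t) < log_cyclotomic (2 * p ^ i) y"
    and "log_cyclotomic (2 * p ^ i) y < log_cyclotomic (p ^ i) y"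
proof -
  define v where "v = y ^ p ^ i"
  have p0: "p > 0" using p by (simp add: prime_gt_0_nat)
  have v: "0 < v" "v < 1" and t: "0 < t" "t < 1"
    using y p0 by (auto simp: v_def t_def power_less_one_iff)
  have Lp: "log_cyclotomic (p ^ i) y = ln (1 - v) - ln (1 - t)"
    unfolding v_def t_def using p i y by (intro log_cyclotomic_prime_power) auto
  have "log_cyclotomic (p ^ i) (y\<^sup>2) = ln (1 - (y\<^sup>2) ^ p ^ i) - ln (1 - (y\<^sup>2) ^ p ^ (i - 1))"
    using p i y by (intro log_cyclotomic_prime_power) (auto simp: power_less_one_iff)
  then have Lp2: "log_cyclotomic (p ^ i) (y\<^sup>2) = ln (1 - v\<^sup>2) - ln (1 - t\<^sup>2)"
    by (simp add: v_def t_def mult.commute flip: power_mult)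
  have "1 - v\<^sup>2 = (1 - v) * (1 + v)" "1 - t\<^sup>2 = (1 - t) * (1 + t)"
    by (simp_all add: power2_eq_square algebra_simps)
  then have L2: "log_cyclotomic (2 * p ^ i) y = ln (1 + v) - ln (1 + t)"
    using log_cyclotomic_mult_prime[of 2 "p ^ i" y] p p0 y Lp Lp2 v t by (simp add: ln_mult)
  have lnv: "ln (1 - v) < 0" "0 < ln (1 + v)" using v by auto
  show "log_cyclotomic (p ^ i) y < - ln (1 - t)" using Lp lnv by simp
  have "ln (1 - t) + ln (1 + t) = ln (1 - t\<^sup>2)"
    using t by (simp add: \<open>1 - t\<^sup>2 = _\<close> ln_mult)
  also have "\<dots> < 0" using t by (simp add: power_less_one_iff)
  finally have lnt: "ln (1 - t) + ln (1 + t) < 0" .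
  then show "ln (1 - t) < log_cyclotomic (2 * p ^ i) y" using L2 lnv by simp
  have "p ^ (i - 1) < p ^ i" using p i prime_gt_1_nat by (intro power_strict_increasing) auto
  from power_strict_decreasing[OF this, of y] have "v < t" unfolding v_def t_def using y by simp
  then have "(1 + v) * (1 - t) < (1 - v) * (1 + t)" by (simp add: algebra_simps)
  then have "ln ((1 + v) * (1 - t)) < ln ((1 - v) * (1 + t))" using v t by simp
  then show "log_cyclotomic (2 * p ^ i) y < log_cyclotomic (p ^ i) y"
    using v t by (simp add: L2 Lp ln_mult)
qed

section \<open>Different totients\<close>

lemma abs_log_cyclotomic_less:
  assumes n: "n > 0" and y: "0 < y" "y < 1/2"
  shows "\<bar>log_cyclotomic n y\<bar> < ln (7 / 2)"
proof -
  obtain s k :: nat and e :: real where nk: "n = s * k" and e: "\<bar>e\<bar> = 1"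
    and est: "\<bar>log_cyclotomic n y - e * ln (1 - y ^ s)\<bar> \<le> - ln (tail_bound (y ^ s))"
    using log_cyclotomic_estimate[OF n] y by metis
  have "y ^ s \<le> y ^ 1" using y n nk by (intro power_decreasing) (auto intro: Suc_leI)
  then have z: "0 < y ^ s" "y ^ s < 1/2" using y by auto
  have "ln (2 / 7) < ln ((1 - y ^ s) * tail_bound (y ^ s))"
    using tail_bound_coarse[OF z] tail_bound_pos[OF z] z by simp
  then have "- ln (7 / 2) < ln (1 - y ^ s) + ln (tail_bound (y ^ s))"
    using tail_bound_pos[OF z] z by (simp add: ln_mult ln_div)
  moreover have "ln (1 - y ^ s) < 0" using z by simp
  then have "\<bar>e * ln (1 - y ^ s)\<bar> = - ln (1 - y ^ s)" using e by (simp add: abs_mult)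
  ultimately show ?thesis using est by linarith
qed

text \<open>One logarithm is controlled by \<open>ln (8 / 7)\<close> and the other by
  \<open>ln (7 / 2)\<close>. Since \<open>8/7 * 7/2 = 4\<close>, their difference stays below the
  gain from \<open>x ^ 2 > 4\<close>.\<close>

lemma cyclotomic_at_less_if_totient_less:
  assumes n: "n > 0" and m: "m > 0" and tot: "totient m + 2 \<le> totient n" and x: "x > 2"
    and small: "log_cyclotomic m (1 / x) < ln (8 / 7) \<or> - ln (8 / 7) < log_cyclotomic n (1 / x)"
  shows "cyclotomic_at m x < cyclotomic_at n x"
proof -
  have y: "0 < 1 / x" "1 / x < 1 / 2" using x by (auto simp: field_simps)
  have "ln (8 / 7) + ln (7 / 2) = ln (4 :: real)" using ln_mult_pos[of "8/7 :: real" "7/2"] by simp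
  then have "log_cyclotomic m (1 / x) - log_cyclotomic n (1 / x) < ln 4"
    using abs_log_cyclotomic_less[OF n y] abs_log_cyclotomic_less[OF m y] small by linarith
  then have "exp (log_cyclotomic m (1 / x)) < exp (ln 4 + log_cyclotomic n (1 / x))" by simp
  then have "exp (log_cyclotomic m (1 / x)) < 2 ^ 2 * exp (log_cyclotomic n (1 / x))"
    by (simp add: exp_add)
  also have "\<dots> \<le> x ^ (totient n - totient m) * exp (log_cyclotomic n (1 / x))"
  proof (rule mult_right_mono)
    have "(2::real) ^ 2 \<le> x ^ 2" using x by (intro power_mono) auto
    also have "\<dots> \<le> x ^ (totient n - totient m)" using x tot by (intro power_increasing) auto
    finally show "(2::real) ^ 2 \<le> x ^ (totient n - totient m)" .
  qed simp
  finally have "x ^ totient m * exp (log_cyclotomic m (1 / x))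
      < x ^ totient m * (x ^ (totient n - totient m) * exp (log_cyclotomic n (1 / x)))"
    using x by simp
  also have "\<dots> = x ^ totient n * exp (log_cyclotomic n (1 / x))"
    using tot by (simp add: mult.assoc[symmetric] flip: power_add)
  finally show ?thesis using n m x by (simp add: cyclotomic_at_eq_exp)
qed

section \<open>Equal totients\<close>

lemma totient_eq_odd_prime_power_imp:
  assumes p: "prime p" "odd p" and i: "i > 0" and n: "n > 0" "p dvd n"
    and tot: "totient n = totient (p ^ i)"
  shows "n = p ^ i \<or> n = 2 * p ^ i"
proof -
  have p0: "p > 1" using p prime_gt_1_nat by blast
  obtain a m where nm: "n = p ^ a * m" and pm: "\<not> p dvd m"
    using multiplicity_decompose'[of n p] n p0 by (metis less_irrefl nat_dvd_1_iff_1)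
  have a: "a > 0" using n(2) pm nm by (cases a) auto
  have "coprime (p ^ a) m" using p pm by (simp add: prime_imp_coprime)
  then have eq: "p ^ (a - 1) * totient m = p ^ (i - 1)"
    using tot a i p0 unfolding nm
    by (simp add: totient_mult_coprime totient_prime_power[OF p(1)])
  \<comment> \<open>\<open>totient m\<close> divides a power of the odd prime \<open>p\<close>, and
    totients are even beyond 2.\<close>
  have "odd (totient m)" using eq p by (metis dvd_mult even_power)
  then have "\<not> m > 2" using totient_even by blast
  then have m: "m = 1 \<or> m = 2" using n nm by (cases m) auto
  then have "totient m = 1" by auto
  with eq p0 a i have "a = i" by (simp add: power_inject_exp)
  with m nm show ?thesis by auto
qed

text \<open>As \<open>s\<close> is prime to \<open>p\<close>, it divides \<open>p - 1\<close>.
  Equality would make \<open>totient k\<close> the power \<open>p ^ (i - 1)\<close>, which is odd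
  and at least 3, hence not a totient. So \<open>2 * s \<le> p - 1 < p ^ (i - 1)\<close>, where
  \<open>i \<ge> 2\<close> enters.\<close>

lemma totient_eq_prime_power_bound:
  assumes p: "prime p" "odd p" and i: "i \<ge> 2" and n: "n = s * k" "n > 0" "\<not> p dvd n"
    and tot: "s * totient k = totient (p ^ i)"
  shows "2 * s < p ^ (i - 1)"
proof -
  have p0: "p \<ge> 3" using p prime_ge_2_nat[of p] by (cases "p = 2") auto
  have tot': "s * totient k = p ^ (i - 1) * (p - 1)"
    using tot p i by (simp add: totient_prime_power)
  have "coprime s p" using n p by (metis coprime_commute dvd_mult2 prime_imp_coprime)
  then have "s dvd p - 1"
    using tot' by (metis coprime_dvd_mult_right_iff coprime_power_right_iff dvd_triv_left)
  then obtain r where r: "p - 1 = s * r" by (elim dvdE)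
  have s: "s > 0" using n by (auto intro: Nat.gr0I)
  have r0: "r > 0" using r p0 by (auto intro: Nat.gr0I)
  have k: "totient k = p ^ (i - 1) * r" using tot' r s by simp
  have "r \<noteq> 1"
  proof
    assume "r = 1"
    then have "odd (totient k)" using k p by simp
    then have "\<not> k > 2" using totient_even by blast
    then have "totient k \<le> 1" using totient_le[of k] by (cases "k = 2") auto
    moreover have "p ^ 1 \<le> p ^ (i - 1)" using p0 i by (intro power_increasing) auto
    ultimately show False using k \<open>r = 1\<close> p0 by simp
  qed
  then have "r \<ge> 2" using r0 by simp
  then have "s * 2 \<le> p - 1" unfolding r by (rule mult_le_mono2)
  moreover have "p ^ 1 \<le> p ^ (i - 1)" using p0 i by (intro power_increasing) auto
  ultimately show ?thesis using p0 by simp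
qed

lemma log_cyclotomic_far_from_zero:
  assumes n: "n > 0" "totient n = totient (p ^ i)" "\<not> p dvd n"
    and p: "prime p" "odd p" and i: "i \<ge> 2" and y: "0 < y" "y < 1/2"
  shows "- ln (1 - y ^ p ^ (i - 1)) < \<bar>log_cyclotomic n y\<bar>"
proof -
  obtain s k :: nat and e :: real where nk: "n = s * k" "totient n = s * totient k" and e: "\<bar>e\<bar> = 1"
    and est: "\<bar>log_cyclotomic n y - e * ln (1 - y ^ s)\<bar> \<le> - ln (tail_bound (y ^ s))"
    using log_cyclotomic_estimate[OF n(1)] y by metis
  have "y ^ s \<le> y ^ 1" using y n nk by (intro power_decreasing) (auto intro: Suc_leI)
  then have z: "0 < y ^ s" "y ^ s < 1/2" using y by auto
  have "2 * s < p ^ (i - 1)"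
    using totient_eq_prime_power_bound[OF p i nk(1) n(1) n(3)] nk n by simp
  \<comment> \<open>The strict bound leaves one spare factor \<open>y < 1/2\<close>, the source of
    the half in \<open>tail_bound_fine\<close>.\<close>
  then have "y ^ p ^ (i - 1) \<le> y ^ (2 * s + 1)" using y by (intro power_decreasing) auto
  also have "\<dots> \<le> (y ^ s) ^ 2 / 2"
    using y mult_left_mono[of y "1/2" "(y ^ s) ^ 2"] by (simp add: power_mult[symmetric] mult.commute)
  finally have t: "y ^ p ^ (i - 1) \<le> (y ^ s) ^ 2 / 2" .
  have z2: "(y ^ s) ^ 2 / 2 < 1" using z power_less_one_iff[of "y ^ s" 2] by simp
  have "ln (1 - y ^ s) < ln (tail_bound (y ^ s) * (1 - (y ^ s) ^ 2 / 2))"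
    using tail_bound_fine[OF z] z by simp
  also have "\<dots> = ln (tail_bound (y ^ s)) + ln (1 - (y ^ s) ^ 2 / 2)"
    using tail_bound_pos[OF z] z2 by (intro ln_mult_pos) auto
  also have "ln (1 - (y ^ s) ^ 2 / 2) \<le> ln (1 - y ^ p ^ (i - 1))"
    using t z2 by (intro ln_mono) auto
  finally have "ln (1 - y ^ s) - ln (tail_bound (y ^ s)) < ln (1 - y ^ p ^ (i - 1))" by simp
  moreover have "ln (1 - y ^ s) < 0" using z by simp
  then have "\<bar>e * ln (1 - y ^ s)\<bar> = - ln (1 - y ^ s)" using e by (simp add: abs_mult)
  ultimately show ?thesis using est by linarith
qed

section \<open>Consecutiveness\<close>

theorem proposition6p2:
  fixes p i :: nat and x :: real
  assumes "prime p" and "odd p" and "i \<ge> 2" and "x > 2"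
  shows "cyclotomic_less x (2 * p ^ i) (p ^ i) \<and>
    \<not> (\<exists>n>0. cyclotomic_less x (2 * p ^ i) n \<and> cyclotomic_less x n (p ^ i))"
proof -
  let ?L = "\<lambda>n. log_cyclotomic n (1 / x)"
  define t where "t = (1 / x) ^ p ^ (i - 1)"
  have y: "0 < 1 / x" "1 / x < 1 / 2" using assms(4) by (auto simp: field_simps)
  have i: "i > 0" using assms(3) by simp
  have p3: "p \<ge> 3" using assms(1,2) prime_ge_2_nat[of p] by (cases "p = 2") auto
  have less_iff: "cyclotomic_less x a b \<longleftrightarrow> cyclotomic_at a x < cyclotomic_at b x" for a b
    by (simp add: cyclotomic_less_def cyclotomic_at_def)
  have same: "cyclotomic_at a x < cyclotomic_at b x \<longleftrightarrow> ?L a < ?L b"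
    if "a > 0" "b > 0" "totient a = totient b" for a b
    using that assms(4) by (simp add: cyclotomic_at_eq_exp)
  have tot2: "totient (2 * p ^ i) = totient (p ^ i)"
    using assms(2) by (simp add: totient_double)
  have pos: "p ^ i > 0" "2 * p ^ i > 0" using p3 by auto
  note bounds = prime_power_bounds[OF assms(1,2) i y, folded t_def]
  have pq: "3 \<le> p ^ (i - 1)"
    using p3 power_increasing[of 1 "i - 1" p] assms(3) by fastforce
  \<comment> \<open>The exponent is at least 3, so \<open>t \<le> 1/8\<close>; this is where
    \<open>8/7\<close> comes from.\<close>
  then have "t \<le> (1 / x) ^ 3" unfolding t_def using y by (intro power_decreasing) auto
  also have "\<dots> \<le> (1 / 2) ^ 3" using y by (intro power_mono) auto
  finally have "7 / 8 \<le> 1 - t" by (simp add: power_one_over)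
  then have "ln (7 / 8) \<le> ln (1 - t)" by (intro ln_mono) auto
  then have t: "- ln (1 - t) \<le> ln (8 / 7)" by (simp add: ln_div)
  have tot_p: "totient (p ^ i) = p ^ (i - 1) * (p - 1)"
    using assms(1) i by (rule totient_prime_power)
  have "\<not> (cyclotomic_at (2 * p ^ i) x < cyclotomic_at n x \<and> cyclotomic_at n x < cyclotomic_at (p ^ i) x)"
    if n: "n > 0" for n
  proof (cases "totient n = totient (p ^ i)")
    case True
    have "\<not> (?L (2 * p ^ i) < ?L n \<and> ?L n < ?L (p ^ i))"
    proof (cases "p dvd n")
      case True
      then show ?thesis
        using totient_eq_odd_prime_power_imp[OF assms(1,2) i n] \<open>totient n = _\<close> by auto
    next
      case False
      \<comment> \<open>Both end values lie strictly between \<open>ln (1 - t)\<close> and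
        \<open>- ln (1 - t)\<close>, while \<open>?L n\<close> lies outside that interval.\<close>
      from log_cyclotomic_far_from_zero[OF n True False assms(1-3) y, folded t_def] bounds
      show ?thesis by linarith
    qed
    then show ?thesis using same[OF pos(2) n] same[OF n pos(1)] tot2 True by auto
  next
    case False
    have even: "even (totient (p ^ i))" using assms(2) by (simp add: tot_p)
    \<comment> \<open>The lower bound covers the only odd totient value, 1; otherwise parity forces
      the gap of 2.\<close>
    have "3 * 2 \<le> totient (p ^ i)" unfolding tot_p using pq p3 by (intro mult_le_mono) auto
    moreover have "totient n \<le> 1 \<or> even (totient n)"
      using totient_even[of n] totient_le[of n] n by (cases "n = 1 \<or> n = 2") auto
    ultimately have "totient n + 2 \<le> totient (p ^ i) \<or> totient (p ^ i) + 2 \<le> totient n"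
      using False even by presburger
    \<comment> \<open>A smaller totient puts \<open>n\<close> below \<open>2 * p ^ i\<close>, a
      larger one puts it above \<open>p ^ i\<close>; in each case the endpoint supplies the
      \<open>8/7\<close> bound.\<close>
    then show ?thesis
    proof
      assume "totient n + 2 \<le> totient (p ^ i)"
      then have "cyclotomic_at n x < cyclotomic_at (2 * p ^ i) x"
        using n pos(2) assms(4) bounds t tot2 by (intro cyclotomic_at_less_if_totient_less) auto
      then show ?thesis by simp
    next
      assume "totient (p ^ i) + 2 \<le> totient n"
      then have "cyclotomic_at (p ^ i) x < cyclotomic_at n x"
        using n pos(1) assms(4) bounds t by (intro cyclotomic_at_less_if_totient_less) auto
      then show ?thesis by simp
    qed
  qed
  then show ?thesis
    using bounds(3) same[OF pos(2,1) tot2] by (auto simp: less_iff)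
qed

end
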